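(* Let $\mu\geq 2$ be an integer. If $T$ is a $\mu$-way $(v,2,1)$ trade, then the volume of $T$ is at least $\lceil\frac{\mu+1}{2}\rceil$.
   Context: For integers $v,k,t$, a $(v,k,t)$ trade is a triple $(X;T_1,T_2)$ where $X$ is a $v$-set and $T_1,T_2$ are disjoint nonempty collections of $k$-subsets (blocks) of $X$ such that every $t$-subset of $X$ is contained in the same number of blocks of $T_1$ as of $T_2$. A $\mu$-way $(v,k,t)$ trade is a pair $T=(X,\{T_1,\dots,T_\mu\})$ such that for every $i\neq j$, $(X;T_i,T_j)$ is a $(v,k,t)$ trade. All $T_i$ then have the same number of blocks, called the volume of $T$. *)

theory Defs
  imports Complex_Main "HOL-Library.Multiset"
begin

text \<open>
  Collections of blocks are multisets, so repeated blocks are allowed; collections without repeated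
  blocks are the special case of multisets of the form \<^term>\<open>mset_set B\<close>. Disjointness means that no
  block occurs in both collections.
\<close>

definition is_trade ::
  "nat \<Rightarrow> nat \<Rightarrow> nat \<Rightarrow> 'a set \<Rightarrow> 'a set multiset \<Rightarrow> 'a set multiset \<Rightarrow> bool" where
  "is_trade v k t X T1 T2 \<longleftrightarrow>
     finite X \<and> card X = v \<and>
     T1 \<noteq> {#} \<and> T2 \<noteq> {#} \<and>
     set_mset T1 \<inter> set_mset T2 = {} \<and>
     (\<forall>B \<in> set_mset T1 \<union> set_mset T2. B \<subseteq> X \<and> card B = k) \<and>
     (\<forall>S. S \<subseteq> X \<and> card S = t \<longrightarrow>
        size {#B \<in># T1. S \<subseteq> B#} = size {#B \<in># T2. S \<subseteq> B#})"

text \<open>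
  The family \<open>T\<^sub>1, \<dots>, T\<^sub>\<mu>\<close> is a function on \<^typ>\<open>nat\<close> of which only the values on
  \<open>{1..\<mu>}\<close> matter.
\<close>

definition is_multiway_trade ::
  "nat \<Rightarrow> nat \<Rightarrow> nat \<Rightarrow> nat \<Rightarrow> 'a set \<Rightarrow> (nat \<Rightarrow> 'a set multiset) \<Rightarrow> bool" where
  "is_multiway_trade \<mu> v k t X T \<longleftrightarrow>
     (\<forall>i \<in> {1..\<mu>}. \<forall>j \<in> {1..\<mu>}. i \<noteq> j \<longrightarrow> is_trade v k t X (T i) (T j))"

definition trade_volume :: "nat \<Rightarrow> (nat \<Rightarrow> 'a set multiset) \<Rightarrow> nat" where
  "trade_volume \<mu> T = (THE m. \<forall>i \<in> {1..\<mu>}. size (T i) = m)"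

end

theory Submission
  imports Defs
begin

text \<open>
  All \<open>T\<^sub>i\<close> have the same degree function on points, hence the same size \<open>m\<close> and the same set \<open>S\<close> of
  covered points, and counting incidences gives \<open>|S| \<le> 2m\<close>. A point \<open>x \<in> S\<close> lies in a block
  \<open>{x, y\<^sub>i}\<close> of every \<open>T\<^sub>i\<close>; disjointness makes the \<open>y\<^sub>i\<close> distinct, so \<open>|S| \<ge> \<mu> + 1\<close>.
\<close>

text \<open>Double counting of incidences: a new block raises the degree of exactly its
  \<open>k\<close> points by one. Degrees are written with \<open>{x} \<subseteq> B\<close> to match
  the condition in \<open>is_trade\<close> for \<open>t = 1\<close>.\<close>

lemma sum_degrees_eq_mult_size:
  assumes "finite X" "\<And>B. B \<in># M \<Longrightarrow> B \<subseteq> X \<and> card B = k"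
  shows "(\<Sum>x\<in>X. size {#B \<in># M. {x} \<subseteq> B#}) = k * size M"
  using assms(2)
proof (induction M)
  case empty
  then show ?case by simp
next
  case (add B M)
  have B: "B \<subseteq> X" "card B = k"
    using add.prems by auto
  have "(\<Sum>x\<in>X. size {#C \<in># add_mset B M. {x} \<subseteq> C#})
      = (\<Sum>x\<in>X. (if x \<in> B then 1 else 0) + size {#C \<in># M. {x} \<subseteq> C#})"
    by (intro sum.cong) auto
  also have "\<dots> = card (X \<inter> B) + k * size M"
    using add assms(1) by (simp add: sum.distrib sum.If_cases)
  also have "X \<inter> B = B"
    using B by auto
  finally show ?case
    using B by simp
qed

lemma card_Union_mset_le:
  assumes "\<And>B. B \<in># M \<Longrightarrow> card B = k"
  shows "card (\<Union>(set_mset M)) \<le> k * size M"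
  using assms
proof (induction M)
  case empty
  then show ?case by simp
next
  case (add B M)
  have "card (\<Union>(set_mset (add_mset B M))) \<le> card B + card (\<Union>(set_mset M))"
    by (simp add: card_Un_le)
  also have "\<dots> \<le> k + k * size M"
    using add by (intro add_mono) auto
  finally show ?case by simp
qed

text \<open>Both collections have the same degree sum over \<open>X\<close>, which is
  \<open>k\<close> times the size of each; \<open>k > 0\<close> allows cancelling.\<close>

lemma is_trade_size_eq:
  assumes "is_trade v k 1 X T1 T2" "k > 0"
  shows "size T1 = size T2"
proof -
  have "k * size T1 = (\<Sum>x\<in>X. size {#B \<in># T1. {x} \<subseteq> B#})"
    using assms by (intro sum_degrees_eq_mult_size[symmetric]) (auto simp: is_trade_def)
  also have "\<dots> = (\<Sum>x\<in>X. size {#B \<in># T2. {x} \<subseteq> B#})"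
  proof (intro sum.cong refl)
    fix x assume "x \<in> X"
    then have "{x} \<subseteq> X \<and> card {x} = 1" by simp
    then show "size {#B \<in># T1. {x} \<subseteq> B#} = size {#B \<in># T2. {x} \<subseteq> B#}"
      using assms(1) unfolding is_trade_def by blast
  qed
  also have "\<dots> = k * size T2"
    using assms by (intro sum_degrees_eq_mult_size) (auto simp: is_trade_def)
  finally show ?thesis
    using assms(2) by simp
qed

lemma is_trade_sym: "is_trade v k t X T1 T2 \<Longrightarrow> is_trade v k t X T2 T1"
  unfolding is_trade_def by (auto simp: Int_commute)

text \<open>A point is covered exactly when its degree is positive, and degrees agree. The reverse
  inclusion follows by \<open>is_trade_sym\<close>.\<close>

lemma is_trade_covers_subset:
  assumes "is_trade v k 1 X T1 T2"
  shows "\<Union>(set_mset T1) \<subseteq> \<Union>(set_mset T2)"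
proof
  fix x assume "x \<in> \<Union>(set_mset T1)"
  then obtain B where B: "B \<in># T1" "x \<in> B" by blast
  then have "{x} \<subseteq> X \<and> card {x} = 1"
    using assms by (auto simp: is_trade_def)
  then have "size {#B \<in># T1. {x} \<subseteq> B#} = size {#B \<in># T2. {x} \<subseteq> B#}"
    using assms unfolding is_trade_def by blast
  moreover have "B \<in># {#B \<in># T1. {x} \<subseteq> B#}"
    using B by simp
  ultimately have "{#B \<in># T2. {x} \<subseteq> B#} \<noteq> {#}"
    by (metis empty_not_add_mset multi_member_split size_eq_0_iff_empty)
  then obtain C where "C \<in># {#B \<in># T2. {x} \<subseteq> B#}"
    by blast
  then show "x \<in> \<Union>(set_mset T2)"
    by auto
qed

lemma multiway_trade_volume_eq:
  assumes "is_multiway_trade \<mu> v k 1 X T" "k > 0" "i \<in> {1..\<mu>}"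
  shows "trade_volume \<mu> T = size (T i)"
  unfolding trade_volume_def
proof (rule the_equality)
  show "\<forall>j \<in> {1..\<mu>}. size (T j) = size (T i)"
    using assms is_trade_size_eq unfolding is_multiway_trade_def by metis
\<comment> \<open>Uniqueness for \<open>THE\<close>: the index range contains \<open>i\<close>, so
  any common size must be \<open>size (T i)\<close>.\<close>
qed (use assms(3) in auto)

lemma multiway_2_1_trade_covers_card:
  assumes "\<mu> \<ge> 2" "is_multiway_trade \<mu> v 2 1 X T"
  shows "\<mu> + 1 \<le> card (\<Union>(set_mset (T 1)))"
proof -
  let ?S = "\<Union>(set_mset (T 1))"
  have trade: "is_trade v 2 1 X (T i) (T j)" if "i \<in> {1..\<mu>}" "j \<in> {1..\<mu>}" "i \<noteq> j" for i j
    using assms that unfolding is_multiway_trade_def by blast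
  have trade12: "is_trade v 2 1 X (T 1) (T 2)"
    using trade assms(1) by simp
  have "finite X" "?S \<subseteq> X"
    using trade12 by (auto simp: is_trade_def)
  then have fin: "finite ?S"
    by (rule finite_subset[rotated])
  have S_eq: "\<Union>(set_mset (T i)) = ?S" if "i \<in> {1..\<mu>}" for i
  proof (cases "i = 1")
    case False
    then have "is_trade v 2 1 X (T 1) (T i)"
      using trade that by simp
    then show ?thesis
      using is_trade_covers_subset is_trade_sym by (metis subset_antisym)
  qed simp
  have card2: "card B = 2" if "i \<in> {1..\<mu>}" "B \<in># T i" for i B
  proof -
    \<comment> \<open>Block sizes are known only through a trade between two distinct indices, so
      \<open>i\<close> needs a partner; \<mu> \<ge> 2 provides one.\<close>
    define j :: nat where "j = (if i = 1 then 2 else 1)"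
    have "j \<in> {1..\<mu>}" "i \<noteq> j"
      using assms(1) by (auto simp: j_def)
    then show ?thesis
      using trade[of i j] that by (auto simp: is_trade_def)
  qed
  obtain B where B: "B \<in># T 1"
    using trade12 unfolding is_trade_def by blast
  then have "card B = 2"
    using card2[of 1] assms(1) by simp
  then obtain x where "x \<in> B"
    by fastforce
  then have x: "x \<in> ?S"
    using B by blast
  \<comment> \<open>\<open>T i\<close> covers the same points as \<open>T 1\<close>, so some block
    of \<open>T i\<close> contains \<open>x\<close>; its other point is the witness.\<close>
  have "\<exists>y. y \<noteq> x \<and> {x, y} \<in># T i" if i: "i \<in> {1..\<mu>}" for i
  proof -
    obtain C where C: "C \<in># T i" "x \<in> C"
      using S_eq[OF i] x by blast
    then obtain a b where "C = {a, b}" "a \<noteq> b"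
      using card2[OF i] by (meson card_2_iff)
    with C show ?thesis
      by (metis insert_commute insert_iff singletonD)
  qed
  then obtain y where y: "\<And>i. i \<in> {1..\<mu>} \<Longrightarrow> y i \<noteq> x \<and> {x, y i} \<in># T i"
    by metis
  have "inj_on y {1..\<mu>}"
  proof (rule inj_onI, rule ccontr)
    \<comment> \<open>Equal partners would put one and the same block \<open>{x, y i}\<close> into
      both \<open>T i\<close> and \<open>T j\<close>, against disjointness.\<close>
    fix i j assume ij: "i \<in> {1..\<mu>}" "j \<in> {1..\<mu>}" "y i = y j" "i \<noteq> j"
    then have "{x, y i} \<in> set_mset (T i) \<inter> set_mset (T j)"
      using y by (metis IntI)
    then show False
      using trade[of i j] ij by (auto simp: is_trade_def)
  qed
  then have "card (y ` {1..\<mu>}) = \<mu>"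
    by (simp add: card_image)
  moreover have "x \<notin> y ` {1..\<mu>}"
    using y by blast
  \<comment> \<open>The point \<open>x\<close> itself supplies the extra 1 beyond its \<mu> distinct
    partners.\<close>
  ultimately have "card (insert x (y ` {1..\<mu>})) = \<mu> + 1"
    by simp
  moreover have "insert x (y ` {1..\<mu>}) \<subseteq> ?S"
    using x y S_eq by blast
  ultimately show ?thesis
    using card_mono[OF fin] by metis
qed

theorem theorem3p2:
  fixes \<mu> v :: nat and X :: "'a set" and T :: "nat \<Rightarrow> 'a set multiset"
  assumes "\<mu> \<ge> 2"
    and "is_multiway_trade \<mu> v 2 1 X T"
  shows "int (trade_volume \<mu> T) \<ge> \<lceil>(real \<mu> + 1) / 2\<rceil>"
proof -
  have "is_trade v 2 1 X (T 1) (T 2)"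
    using assms unfolding is_multiway_trade_def by simp
  then have "card (\<Union>(set_mset (T 1))) \<le> 2 * size (T 1)"
    by (intro card_Union_mset_le) (auto simp: is_trade_def)
  moreover have "trade_volume \<mu> T = size (T 1)"
    using assms by (intro multiway_trade_volume_eq) auto
  ultimately have "\<mu> + 1 \<le> 2 * trade_volume \<mu> T"
    using multiway_2_1_trade_covers_card[OF assms] by simp
  then show ?thesis
    \<comment> \<open>The volume is an integer, so bounding the ceiling amounts to bounding the real
      number (\<mu> + 1) / 2.\<close>
    by (simp add: ceiling_le_iff)
qed

end
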